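(* For every integer $n\ge2$, $[-1,1]\subseteq\Lambda(\mathrm{PDS}_n)$.
   Context: A real matrix is doubly stochastic if its entries are nonnegative and every row and column sums to $1$. A matrix is permutative if every row is a permutation of its first row. $\mathrm{PDS}_n$ is the set of all $n\times n$ matrices that are both permutative and doubly stochastic. For a set $S$ of matrices, $\Lambda(S)\subseteq\mathbb{C}$ is the set of all complex numbers that are eigenvalues of some matrix in $S$. *)

theory Defs
  imports "Jordan_Normal_Form.Char_Poly"
begin

definition doubly_stochastic :: "real mat \<Rightarrow> bool" where
  "doubly_stochastic A \<longleftrightarrow>
     square_mat A \<and>
     (\<forall>i<dim_row A. \<forall>j<dim_col A. 0 \<le> A $$ (i, j)) \<and>
     (\<forall>i<dim_row A. (\<Sum>j<dim_col A. A $$ (i, j)) = 1) \<and>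
     (\<forall>j<dim_col A. (\<Sum>i<dim_row A. A $$ (i, j)) = 1)"

(* The permutation may differ from row to row. *)
definition permutative :: "'a mat \<Rightarrow> bool" where
  "permutative A \<longleftrightarrow>
     (\<forall>i<dim_row A. \<exists>\<pi>. \<pi> permutes {..<dim_col A} \<and>
        (\<forall>j<dim_col A. A $$ (i, j) = A $$ (0, \<pi> j)))"

definition PDS :: "nat \<Rightarrow> real mat set" where
  "PDS n = {A \<in> carrier_mat n n. permutative A \<and> doubly_stochastic A}"

(* Eigenvalues are taken over the complex numbers, so real matrices are embedded entrywise. *)
definition Lambda :: "real mat set \<Rightarrow> complex set" where
  "Lambda S = {z. \<exists>A\<in>S. eigenvalue (map_mat complex_of_real A) z}"

end

theory Submission
  imports Defs
begin

text \<open>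
  Let \<open>P\<close> be a permutation matrix of order \<open>n\<close>, \<open>J\<close> the all-ones matrix and \<open>t \<in> [0,1]\<close>. The convex
  combination \<open>t P + ((1 - t) / n) J\<close> of two doubly stochastic matrices is doubly stochastic, and
  it is permutative because every row has the same constant entries except for one entry raised
  by \<open>t\<close>. On vectors whose coordinates sum to \<open>0\<close> the matrix \<open>J\<close> vanishes, so there the combination
  acts as \<open>t P\<close>: an eigenvalue \<open>s\<close> of \<open>P\<close> with such an eigenvector becomes the eigenvalue \<open>t s\<close>.

  The vector \<open>e\<^sub>0 - e\<^sub>1\<close> has coordinate sum \<open>0\<close>. It is fixed by the identity and negated by the
  transposition of \<open>0\<close> and \<open>1\<close>. With \<open>t = \<bar>x\<bar>\<close>, the identity realises every \<open>x \<in> [0,1]\<close> and the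
  transposition every \<open>x \<in> [-1,0]\<close>, for all \<open>n \<ge> 2\<close> at once.
\<close>

definition smoothed_perm_mat :: "nat \<Rightarrow> (nat \<Rightarrow> nat) \<Rightarrow> real \<Rightarrow> real mat" where
  "smoothed_perm_mat n p t = mat n n (\<lambda>(i, j). (1 - t) / real n + (if j = p i then t else 0))"

lemma smoothed_perm_mat_in_PDS:
  assumes p: "p permutes {..<n}" and t: "0 \<le> t" "t \<le> 1"
  shows "smoothed_perm_mat n p t \<in> PDS n"
proof -
  let ?A = "smoothed_perm_mat n p t"
  have p_less: "p i < n" if "i < n" for i
    using permutes_in_image[OF p, of i] that by simp
  have "permutative ?A"
    unfolding permutative_def
  proof (intro allI impI)
    fix i assume "i < dim_row ?A"
    then have i: "i < n" by (simp add: smoothed_perm_mat_def)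
    \<comment> \<open>The raised entry sits in column \<open>p 0\<close> of the first row and in column \<open>p i\<close> of row \<open>i\<close>.\<close>
    let ?\<pi> = "transpose (p 0) (p i)"
    have "?\<pi> permutes {..<n}"
      using i p_less by (intro permutes_swap_id) auto
    moreover have "?A $$ (i, j) = ?A $$ (0, ?\<pi> j)" if "j < n" for j
    proof -
      have "?\<pi> j < n"
        using i that p_less[of 0] p_less[of i] by (auto simp: transpose_def)
      then show ?thesis
        using i that by (auto simp: smoothed_perm_mat_def transpose_def)
    qed
    ultimately show "\<exists>\<pi>. \<pi> permutes {..<dim_col ?A} \<and>
        (\<forall>j<dim_col ?A. ?A $$ (i, j) = ?A $$ (0, \<pi> j))"
      by (auto simp: smoothed_perm_mat_def)
  qed
  moreover have "doubly_stochastic ?A"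
  proof -
    have row: "(\<Sum>j<n. ?A $$ (i, j)) = 1" if "i < n" for i
      using that p_less[OF that]
      by (simp add: smoothed_perm_mat_def sum.distrib sum.delta)
    \<comment> \<open>Column \<open>j\<close> has exactly one raised entry because \<open>p\<close> is a bijection: reindex by \<open>p\<close>.\<close>
    have col: "(\<Sum>i<n. ?A $$ (i, j)) = 1" if "j < n" for j
    proof -
      have "(\<Sum>i<n. if j = p i then t else 0) = (\<Sum>i<n. if j = i then t else 0)"
        using sum.permute[OF p, of "\<lambda>i. if j = i then t else 0"] by (simp add: o_def)
      with that show ?thesis
        by (simp add: smoothed_perm_mat_def sum.distrib)
    qed
    show ?thesis
      using row col t by (auto simp: doubly_stochastic_def smoothed_perm_mat_def)
  qed
  ultimately show ?thesis
    by (simp add: PDS_def smoothed_perm_mat_def)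
qed

text \<open>
  Row \<open>i\<close> of the permutation matrix has its \<open>1\<close> in column \<open>p i\<close>, so it sends \<open>v\<close> to \<open>v \<circ> p\<close>; the
  uniform part multiplies the coordinate sum of \<open>v\<close>, which is \<open>0\<close>.
\<close>
lemma eigenvalue_smoothed_perm_mat:
  fixes v :: "nat \<Rightarrow> complex"
  assumes p: "p permutes {..<n}"
    and sum0: "(\<Sum>i<n. v i) = 0"
    and nonzero: "k < n" "v k \<noteq> 0"
    and eigen: "\<And>i. i < n \<Longrightarrow> v (p i) = s * v i"
  shows "eigenvalue (map_mat complex_of_real (smoothed_perm_mat n p t)) (of_real t * s)"
proof -
  let ?A = "map_mat complex_of_real (smoothed_perm_mat n p t)"
  have "?A *\<^sub>v vec n v = (of_real t * s) \<cdot>\<^sub>v vec n v"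
  proof (rule eq_vecI)
    fix i assume "i < dim_vec ((of_real t * s) \<cdot>\<^sub>v vec n v)"
    then have i: "i < n" by simp
    then have pi: "p i < n"
      using permutes_in_image[OF p, of i] by simp
    have "(?A *\<^sub>v vec n v) $ i =
        (\<Sum>j<n. of_real ((1 - t) / real n) * v j + (if j = p i then of_real t * v j else 0))"
      using i by (auto simp: smoothed_perm_mat_def scalar_prod_def atLeast0LessThan
          algebra_simps intro!: sum.cong)
    also have "\<dots> = of_real ((1 - t) / real n) * (\<Sum>j<n. v j) + of_real t * v (p i)"
      using pi by (simp add: sum.distrib sum_distrib_left)
    also have "\<dots> = of_real t * s * v i"
      using sum0 eigen[OF i] by simp
    finally show "(?A *\<^sub>v vec n v) $ i = ((of_real t * s) \<cdot>\<^sub>v vec n v) $ i"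
      using i by simp
  qed (simp add: smoothed_perm_mat_def)
  moreover have "vec n v \<noteq> 0\<^sub>v n"
    using nonzero by (metis index_vec index_zero_vec(1))
  ultimately show ?thesis
    by (auto simp: eigenvalue_def eigenvector_def smoothed_perm_mat_def
        intro!: exI[of _ "vec n v"])
qed

theorem theorem3p15:
  fixes n :: nat
  assumes "n \<ge> 2"
  shows "complex_of_real ` {-1..1} \<subseteq> Lambda (PDS n)"
proof
  fix z assume "z \<in> complex_of_real ` {-1..1}"
  then obtain x :: real where x: "-1 \<le> x" "x \<le> 1" and z: "z = of_real x" by auto
  define p :: "nat \<Rightarrow> nat" where "p = (if 0 \<le> x then id else transpose 0 1)"
  define s :: complex where "s = (if 0 \<le> x then 1 else -1)"
  define v :: "nat \<Rightarrow> complex" where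
    "v i = (if i = 0 then 1 else 0) - (if i = 1 then 1 else 0)" for i
  have p: "p permutes {..<n}"
    using assms by (auto simp: p_def permutes_id intro: permutes_swap_id)
  have "(\<Sum>i<n. v i) = 0"
    using assms by (simp add: v_def sum_subtractf)
  moreover have "v (p i) = s * v i" for i
    by (auto simp: v_def p_def s_def transpose_def)
  ultimately have
    "eigenvalue (map_mat complex_of_real (smoothed_perm_mat n p \<bar>x\<bar>)) (of_real \<bar>x\<bar> * s)"
    using assms by (intro eigenvalue_smoothed_perm_mat[OF p, of v 0]) (auto simp: v_def)
  moreover have "of_real \<bar>x\<bar> * s = z"
    by (simp add: z s_def)
  moreover have "smoothed_perm_mat n p \<bar>x\<bar> \<in> PDS n"
    using x by (intro smoothed_perm_mat_in_PDS[OF p]) auto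
  ultimately show "z \<in> Lambda (PDS n)"
    unfolding Lambda_def by auto
qed

end
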